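(* Let $p>1$ and $0<\alpha\le1$. If $\alpha p>1$, then there exists a constant $C_{\alpha,p}>0$ such that $$\|f\|_{\mathcal E^p}\le C_{\alpha,p}\|f\|_{C^\alpha},\qquad f\in C^\alpha([0,1]).$$ In particular, $C^\alpha([0,1])\subset\mathcal E^p$.
   Context: $C([0,1])$ denotes the real-valued continuous functions on $[0,1]$, $\|\cdot\|_\infty$ the uniform norm. For $0<\alpha\le1$, $[f]_\alpha=\sup_{0\le s\ne t\le1}\frac{|f(t)-f(s)|}{|t-s|^\alpha}$, $\|f\|_{C^\alpha}=\|f\|_\infty+[f]_\alpha$, and $C^\alpha([0,1])$ is the space of $\alpha$-H\"older continuous functions on $[0,1]$. $\mathbb N_0=\{0,1,2,\dots\}$, $\mathbb N_{-1}=\{-1,0,1,\dots\}$. For $n\in\mathbb N_0$: $t_{n,k}=k2^{-n}$ for $0\le k\le 2^n$, $I_n=\{0,\dots,2^n-1\}$. Faber--Schauder coefficients of $f\in C([0,1])$: $\theta^f_{-1,0}=f(1)-f(0)$, and for $n\ge0$, $k\in I_n$, $\theta^f_{n,k}=2^{n/2}\big(2f(t_{n+1,2k+1})-f(t_{n,k})-f(t_{n,k+1})\big)$. Level energies ($p>1$): $\zeta_f^{(p)}(-1)=2^{1-\frac1p}|\theta^f_{-1,0}|$ and $\zeta_f^{(p)}(n)=\big(2^{-np/2}\sum_{k\in I_n}|\theta^f_{n,k}|^p\big)^{1/p}$ for $n\ge0$. Schauder tail sequence: $H_f(n)=\sum_{m=n}^\infty 2^{-m/2}\sup_{k\in I_m}|\theta^f_{m,k}|\in[0,\infty]$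 for $n\ge0$. Energy space ($p>1$): $\|f\|_{\mathcal E^p}=\|f\|_\infty+\|\zeta_f^{(p)}\|_{\ell^p(\mathbb N_{-1})}+\|H_f\|_{\ell^p(\mathbb N_0)}$ and $\mathcal E^p=\{f\in C([0,1]):\|f\|_{\mathcal E^p}<\infty\}$. *)

theory Defs
  imports "HOL-Analysis.Analysis"
begin

text \<open>
  Functions on the unit interval are total functions \<open>real \<Rightarrow> real\<close> of which only the values on
  \<open>{0..1}\<close> matter. Norms and seminorms take values in \<open>ennreal\<close>, so that a divergent norm is
  \<open>\<infinity>\<close> rather than a junk real number.
\<close>

definition C01 :: "(real \<Rightarrow> real) set" where
  "C01 = {f. continuous_on {0..1} f}"

definition unif_norm :: "(real \<Rightarrow> real) \<Rightarrow> ennreal" where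
  "unif_norm f = (SUP t\<in>{0..1}. ennreal \<bar>f t\<bar>)"

definition holder_seminorm :: "real \<Rightarrow> (real \<Rightarrow> real) \<Rightarrow> ennreal" where
  "holder_seminorm \<alpha> f =
     (SUP (s, t)\<in>{(s, t). s \<in> {0..1} \<and> t \<in> {0..1} \<and> s \<noteq> t}.
        ennreal (\<bar>f t - f s\<bar> / \<bar>t - s\<bar> powr \<alpha>))"

definition holder_norm :: "real \<Rightarrow> (real \<Rightarrow> real) \<Rightarrow> ennreal" where
  "holder_norm \<alpha> f = unif_norm f + holder_seminorm \<alpha> f"

definition holder_space :: "real \<Rightarrow> (real \<Rightarrow> real) set" where
  "holder_space \<alpha> = {f. holder_seminorm \<alpha> f < \<infinity>}"

text \<open>
  Levels are integers, so that \<open>-1\<close> is an ordinary index and \<open>{-1..}\<close> is the index set of the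
  level energies. Values at levels below \<open>-1\<close> are never used.
\<close>

definition dyadic :: "int \<Rightarrow> nat \<Rightarrow> real" where
  "dyadic n k = real k * 2 powi (- n)"

definition level_indices :: "int \<Rightarrow> nat set" where
  "level_indices n = {0..<2 ^ nat n}"

definition schauder_coeff :: "(real \<Rightarrow> real) \<Rightarrow> int \<Rightarrow> nat \<Rightarrow> real" where
  "schauder_coeff f n k =
     (if n = -1 then f 1 - f 0
      else 2 powr (real_of_int n / 2) *
        (2 * f (dyadic (n + 1) (2 * k + 1)) - f (dyadic n k) - f (dyadic n (k + 1))))"

definition level_energy :: "real \<Rightarrow> (real \<Rightarrow> real) \<Rightarrow> int \<Rightarrow> real" where
  "level_energy p f n =
     (if n = -1 then 2 powr (1 - 1 / p) * \<bar>schauder_coeff f (-1) 0\<bar>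
      else (2 powr (- (real_of_int n * p / 2)) *
        (\<Sum>k\<in>level_indices n. \<bar>schauder_coeff f n k\<bar> powr p)) powr (1 / p))"

definition schauder_tail :: "(real \<Rightarrow> real) \<Rightarrow> nat \<Rightarrow> ennreal" where
  "schauder_tail f n =
     (\<Sum>\<^sub>\<infinity>m\<in>{n..}. ennreal (2 powr (- (real m / 2))) *
        (SUP k\<in>level_indices (int m). ennreal \<bar>schauder_coeff f (int m) k\<bar>))"

text \<open>Power of an extended nonnegative real, for exponents \<open>a > 0\<close> only.\<close>

definition ennreal_powr :: "ennreal \<Rightarrow> real \<Rightarrow> ennreal" where
  "ennreal_powr x a = (if x = \<infinity> then \<infinity> else ennreal (enn2real x powr a))"

definition lp_norm :: "real \<Rightarrow> 'i set \<Rightarrow> ('i \<Rightarrow> ennreal) \<Rightarrow> ennreal" where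
  "lp_norm p I a = ennreal_powr (\<Sum>\<^sub>\<infinity>i\<in>I. ennreal_powr (a i) p) (1 / p)"

definition energy_norm :: "real \<Rightarrow> (real \<Rightarrow> real) \<Rightarrow> ennreal" where
  "energy_norm p f =
     unif_norm f + lp_norm p {-1..} (\<lambda>n. ennreal (level_energy p f n))
       + lp_norm p UNIV (schauder_tail f)"

definition energy_space :: "real \<Rightarrow> (real \<Rightarrow> real) set" where
  "energy_space p = {f \<in> C01. energy_norm p f < \<infinity>}"

end

theory Submission
  imports Defs
begin

text \<open>
  The second difference defining a Schauder coefficient at level \<open>n\<close> is the difference of two increments
  of \<open>f\<close> over half a dyadic interval, that is, over steps of length \<open>2\<^bsup>-(n+1)\<^esup>\<close>. If \<open>L\<close> is the Hoelder
  constant of \<open>f\<close>, each increment is at most \<open>L * 2\<^bsup>-(n+1)\<alpha>\<^esup>\<close>, so every coefficient satisfies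
  \<open>\<bar>\<theta>\<^sub>n\<^sub>,\<^sub>k\<bar> \<le> 2\<^bsup>n/2\<^esup> * 2\<^bsup>1-\<alpha>\<^esup> * L * 2\<^bsup>-n\<alpha>\<^esup>\<close> (lemma \<open>schauder_coeff_le\<close>). Both
  sequence norms are then dominated by geometric series.

  The weights \<open>2\<^bsup>-n/2\<^esup>\<close> in the level energy and in the Schauder tail cancel the factor
  \<open>2\<^bsup>n/2\<^esup>\<close>. The level energy combines \<open>2\<^bsup>n\<^esup>\<close> coefficients in an \<open>\<ell>\<^sup>p\<close> sum, which costs
  a factor \<open>2\<^bsup>n/p\<^esup>\<close>; what remains is \<open>2\<^bsup>1-\<alpha>\<^esup> * L * r\<^sup>n\<close> with \<open>r = 2\<^bsup>1/p-\<alpha>\<^esup>\<close>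
  (lemma \<open>level_energy_le\<close>). The hypothesis \<open>\<alpha> p > 1\<close> says exactly that \<open>r < 1\<close>, which makes this
  sequence \<open>p\<close>-summable. The Schauder tail sees only the largest coefficient of a level, so no such
  factor is lost: it is a tail of the geometric series with ratio \<open>2\<^bsup>-\<alpha>\<^esup> < 1\<close> and hence is itself
  geometric (lemma \<open>schauder_tail_le\<close>). Both bounds are linear in \<open>L\<close>, with factors that depend
  only on \<open>\<alpha>\<close> and \<open>p\<close>, and \<open>L\<close> is at most the Hoelder norm.

  The inclusion of the spaces needs in addition that the Hoelder norm is finite as soon as the
  seminorm is: a function with finite seminorm is continuous, hence bounded on the compact interval.
\<close>

section \<open>Geometric series and weighted sequence norms\<close>

lemma has_sum_geometric_atLeast:
  fixes r :: real
  assumes "0 \<le> r" "r < 1"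
  shows "((\<lambda>m. r ^ m) has_sum r ^ n / (1 - r)) {n..}"
proof -
  have "(\<lambda>m. r ^ n * r ^ m) sums (r ^ n * (1 / (1 - r)))"
    using assms by (intro sums_mult geometric_sums) auto
  then have "((\<lambda>m. r ^ n * r ^ m) has_sum r ^ n / (1 - r)) UNIV"
    using assms by (intro sums_nonneg_imp_has_sum) auto
  moreover have "bij_betw (\<lambda>m. n + m) UNIV {n..}"
    by (rule bij_betwI[where g = "\<lambda>m. m - n"]) auto
  ultimately show ?thesis
    using has_sum_reindex_bij_betw[of "\<lambda>m. n + m" UNIV "{n..}" "\<lambda>m. r ^ m"]
    by (simp add: power_add)
qed

lemma has_sum_powr_int_atLeast:
  fixes r :: real
  assumes "0 < r" "r < 1"
  shows "((\<lambda>n. r powr real_of_int n) has_sum 1 / (r * (1 - r))) {-1..}"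
proof -
  have "((\<lambda>m. (1 / r) * r ^ m) has_sum (1 / r) * (r ^ 0 / (1 - r))) {0..}"
    using assms by (intro has_sum_cmult_right has_sum_geometric_atLeast) auto
  then have "((\<lambda>m. (1 / r) * r ^ m) has_sum 1 / (r * (1 - r))) UNIV"
    by (simp add: atLeast_0)
  moreover have "bij_betw (\<lambda>m. int m - 1) UNIV {-1..}"
    by (rule bij_betwI[where g = "\<lambda>n. nat (n + 1)"]) auto
  ultimately show ?thesis
    using assms
    by (subst has_sum_reindex_bij_betw[symmetric]) (auto simp: powr_diff powr_realpow)
qed

lemma infsum_ennreal_le:
  assumes "(g has_sum s) A" and "\<And>x. x \<in> A \<Longrightarrow> 0 \<le> g x"
    and "\<And>x. x \<in> A \<Longrightarrow> F x \<le> ennreal (g x)"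
  shows "infsum F A \<le> ennreal s"
proof (rule infsum_le_finite_sums)
  fix X assume X: "finite X" "X \<subseteq> A"
  have "sum F X \<le> (\<Sum>x\<in>X. ennreal (g x))"
    using X assms(3) by (intro sum_mono) auto
  also have "\<dots> = ennreal (sum g X)"
    using X assms(2) by (intro sum_ennreal) auto
  also have "\<dots> \<le> ennreal s"
    using X assms by (intro ennreal_leI finite_sum_le_has_sum[OF assms(1)]) auto
  finally show "sum F X \<le> ennreal s" .
qed (simp add: nonneg_summable_on_complete)

lemma ennreal_powr_le:
  assumes "x \<le> ennreal c" "0 \<le> c" "0 \<le> a"
  shows "ennreal_powr x a \<le> ennreal (c powr a)"
proof -
  have "x < top"
    using assms(1) by (simp add: le_less_trans)
  moreover have "enn2real x \<le> c"
    using enn2real_mono[OF assms(1)] assms(2) by simp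
  ultimately show ?thesis
    using assms(3) by (auto simp: ennreal_powr_def intro!: ennreal_leI powr_mono2)
qed

text \<open>
  The constant \<open>c\<close> is kept apart from the weights \<open>b\<close>: taking \<open>b\<close> geometric and putting the
  Hoelder constant into \<open>c\<close> gives a bound that is linear in the Hoelder constant.
\<close>

lemma lp_norm_le:
  assumes "0 < p" "0 \<le> c" and "((\<lambda>i. b i powr p) has_sum s) I"
    and "\<And>i. i \<in> I \<Longrightarrow> 0 \<le> b i"
    and "\<And>i. i \<in> I \<Longrightarrow> a i \<le> ennreal (c * b i)"
  shows "lp_norm p I a \<le> ennreal (c * s powr (1 / p))"
proof -
  have "0 \<le> s"
    using assms(3) by (rule has_sum_nonneg) auto
  have "(\<Sum>\<^sub>\<infinity>i\<in>I. ennreal_powr (a i) p) \<le> ennreal (c powr p * s)"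
  proof (rule infsum_ennreal_le)
    show "((\<lambda>i. c powr p * b i powr p) has_sum c powr p * s) I"
      using assms(3) by (rule has_sum_cmult_right)
    show "ennreal_powr (a i) p \<le> ennreal (c powr p * b i powr p)" if "i \<in> I" for i
      using ennreal_powr_le[OF assms(5)[OF that], of p] assms(1,2) assms(4)[OF that]
      by (simp add: powr_mult)
  qed auto
  from ennreal_powr_le[OF this, of "1 / p"] show ?thesis
    using assms(1,2) \<open>0 \<le> s\<close> by (simp add: lp_norm_def powr_mult powr_powr)
qed

section \<open>Hoelder functions on the unit interval\<close>

abbreviation holder_const :: "real \<Rightarrow> (real \<Rightarrow> real) \<Rightarrow> real" where
  "holder_const \<alpha> f \<equiv> enn2real (holder_seminorm \<alpha> f)"

lemma holder_increment_le:
  assumes "f \<in> holder_space \<alpha>" "s \<in> {0..1}" "t \<in> {0..1}"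
  shows "\<bar>f t - f s\<bar> \<le> holder_const \<alpha> f * \<bar>t - s\<bar> powr \<alpha>"
proof (cases "s = t")
  case False
  have fin: "holder_seminorm \<alpha> f < top"
    using assms(1) by (simp add: holder_space_def)
  have "ennreal (\<bar>f t - f s\<bar> / \<bar>t - s\<bar> powr \<alpha>) \<le> holder_seminorm \<alpha> f"
    unfolding holder_seminorm_def using assms False by (intro SUP_upper2[of "(s, t)"]) auto
  from enn2real_mono[OF this fin]
  have "\<bar>f t - f s\<bar> / \<bar>t - s\<bar> powr \<alpha> \<le> holder_const \<alpha> f"
    by simp
  with False show ?thesis
    by (simp add: pos_divide_le_eq)
qed auto

lemma holder_imp_continuous_on:
  assumes "f \<in> holder_space \<alpha>" "0 < \<alpha>"
  shows "continuous_on {0..1} f"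
  unfolding continuous_on_def
proof
  fix s :: real assume s: "s \<in> {0..1}"
  have "((\<lambda>t. \<bar>t - s\<bar>) \<longlongrightarrow> 0) (at s within {0..1})"
    by (auto intro!: tendsto_eq_intros)
  then have "((\<lambda>t. \<bar>t - s\<bar> powr \<alpha>) \<longlongrightarrow> 0) (at s within {0..1})"
    using assms(2) by (intro tendsto_zero_powrI[where b = \<alpha>]) auto
  from tendsto_mult_right_zero[OF this, of "holder_const \<alpha> f"]
  have "((\<lambda>t. f t - f s) \<longlongrightarrow> 0) (at s within {0..1})"
    by (rule Lim_null_comparison[rotated])
      (use holder_increment_le[OF assms(1) s] in \<open>auto simp: eventually_at_filter\<close>)
  then show "(f \<longlongrightarrow> f s) (at s within {0..1})"
    by (simp add: LIM_zero_iff)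
qed

lemma unif_norm_finite:
  assumes "continuous_on {0..1} f"
  shows "unif_norm f < top"
proof -
  have "bounded (f ` {0..1})"
    using assms by (intro compact_imp_bounded compact_continuous_image) auto
  then obtain B where "\<And>t. t \<in> {0..1} \<Longrightarrow> \<bar>f t\<bar> \<le> B"
    unfolding bounded_iff real_norm_def by blast
  then have "unif_norm f \<le> ennreal B"
    unfolding unif_norm_def by (intro SUP_least ennreal_leI)
  then show ?thesis
    by (simp add: le_less_trans)
qed

section \<open>Decay of the Schauder coefficients\<close>

lemma dyadic_of_nat: "dyadic (int n) k = real k / 2 ^ n"
  by (simp add: dyadic_def power_int_minus field_simps)

text \<open>
  With \<open>c\<close> the midpoint of the dyadic interval from \<open>a\<close> to \<open>b\<close>, the second difference is
  \<open>(f c - f a) - (f b - f c)\<close>, a difference of two increments over steps of length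
  \<open>2\<^bsup>-(n+1)\<^esup>\<close>.
\<close>

lemma schauder_coeff_le:
  assumes "f \<in> holder_space \<alpha>" "k \<in> level_indices (int n)"
  shows "\<bar>schauder_coeff f (int n) k\<bar>
    \<le> 2 powr (real n / 2) * (2 powr (1 - \<alpha>) * holder_const \<alpha> f * 2 powr (- (\<alpha> * real n)))"
proof -
  define a where "a = dyadic (int n) k"
  define b where "b = dyadic (int n) (k + 1)"
  define c where "c = dyadic (int n + 1) (2 * k + 1)"
  have c: "c = real (2 * k + 1) / 2 ^ Suc n"
    unfolding c_def using dyadic_of_nat[of "Suc n" "2 * k + 1"] by (simp add: add.commute)
  have "real k + 1 \<le> real (2 ^ n)"
    using assms(2) unfolding level_indices_def by (metis atLeastLessThan_iff nat_int of_nat_1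
      of_nat_add of_nat_le_iff Suc_eq_plus1 Suc_leI)
  then have k: "real k + 1 \<le> 2 ^ n"
    by simp
  have steps: "c - a = 1 / 2 ^ Suc n" "b - c = 1 / 2 ^ Suc n"
    unfolding c a_def b_def dyadic_of_nat by (simp_all add: field_simps)
  have "0 \<le> a" "b \<le> 1"
    unfolding a_def b_def dyadic_of_nat using k by (auto simp: divide_le_eq)
  moreover have "(0::real) < 1 / 2 ^ Suc n"
    by simp
  ultimately have mem: "a \<in> {0..1}" "b \<in> {0..1}" "c \<in> {0..1}"
    using steps unfolding atLeastAtMost_iff by linarith+
  have size: "(1 / 2 ^ Suc n) powr \<alpha> = 2 powr (- \<alpha>) * (2::real) powr (- (\<alpha> * real n))"
  proof -
    have "1 / 2 ^ Suc n = (2::real) powr (- real (Suc n))"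
      by (simp only: powr_minus_divide powr_realpow zero_less_numeral)
    then show ?thesis
      by (simp add: powr_powr powr_add[symmetric] algebra_simps)
  qed
  have "\<bar>2 * f c - f a - f b\<bar> \<le> \<bar>f c - f a\<bar> + \<bar>f b - f c\<bar>"
    by linarith
  also have "\<dots> \<le> holder_const \<alpha> f * \<bar>c - a\<bar> powr \<alpha> + holder_const \<alpha> f * \<bar>b - c\<bar> powr \<alpha>"
    using assms(1) mem by (intro add_mono holder_increment_le)
  also have "\<dots> = 2 * holder_const \<alpha> f * (1 / 2 ^ Suc n) powr \<alpha>"
    unfolding steps by simp
  also have "\<dots> = 2 powr (1 - \<alpha>) * holder_const \<alpha> f * 2 powr (- (\<alpha> * real n))"
    unfolding size by (simp add: powr_diff powr_minus field_simps)
  finally show ?thesis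
    unfolding schauder_coeff_def a_def b_def c_def by (simp add: abs_mult)
qed

text \<open>
  The factor \<open>2\<^bsup>1-1/p\<^esup>\<close> in the energy of level \<open>-1\<close> equals \<open>2\<^bsup>1-\<alpha>\<^esup> * r\<^bsup>-1\<^esup>\<close> for
  \<open>r = 2\<^bsup>1/p-\<alpha>\<^esup>\<close>, so a single geometric bound covers that level as well.
\<close>

lemma level_energy_le:
  assumes "f \<in> holder_space \<alpha>" "1 < p" "-1 \<le> n"
  shows "level_energy p f n
    \<le> 2 powr (1 - \<alpha>) * holder_const \<alpha> f * (2 powr (1 / p - \<alpha>)) powr real_of_int n"
proof (cases "n = -1")
  case True
  have "\<bar>f 1 - f 0\<bar> \<le> holder_const \<alpha> f"
    using holder_increment_le[OF assms(1), of 0 1] by simp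
  moreover have "(2::real) powr (1 - \<alpha>) * (2 powr (1 / p - \<alpha>)) powr (-1) = 2 powr (1 - 1 / p)"
    by (simp only: powr_powr powr_add[symmetric]) (simp add: algebra_simps)
  ultimately show ?thesis
    unfolding True level_energy_def schauder_coeff_def
    by (simp add: mult.commute mult.left_commute mult_left_mono)
next
  case False
  with assms(3) obtain m where n: "n = int m"
    using nonneg_int_cases[of n] by force
  define B where "B = 2 powr (1 - \<alpha>) * holder_const \<alpha> f * 2 powr (- (\<alpha> * real m))"
  have "0 \<le> B"
    by (simp add: B_def)
  have "(\<Sum>k\<in>level_indices n. \<bar>schauder_coeff f n k\<bar> powr p)
      \<le> (\<Sum>k\<in>level_indices n. (2 powr (real m / 2) * B) powr p)"
    using schauder_coeff_le[OF assms(1)] assms(2) unfolding n B_def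
    by (intro sum_mono powr_mono2) auto
  also have "\<dots> = 2 powr real m * (2 powr (real m / 2) * B) powr p"
    by (simp add: n level_indices_def powr_realpow)
  also have "\<dots> = 2 powr real m * (2 powr (real m * p / 2) * B powr p)"
    using \<open>0 \<le> B\<close> by (simp add: powr_mult powr_powr)
  finally have "2 powr (- (real m * p / 2)) * (\<Sum>k\<in>level_indices n. \<bar>schauder_coeff f n k\<bar> powr p)
      \<le> 2 powr (- (real m * p / 2)) * (2 powr real m * (2 powr (real m * p / 2) * B powr p))"
    by (intro mult_left_mono) auto
  also have "\<dots> = 2 powr real m * B powr p"
    by (simp add: powr_minus)
  finally have "level_energy p f n \<le> (2 powr real m * B powr p) powr (1 / p)"
    using assms(2) unfolding level_energy_def n
    by (auto intro!: powr_mono2 mult_nonneg_nonneg sum_nonneg)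
  also have "\<dots> = 2 powr (real m / p) * B"
    using assms(2) \<open>0 \<le> B\<close> by (simp add: powr_mult powr_powr)
  also have "\<dots> = 2 powr (1 - \<alpha>) * holder_const \<alpha> f * (2 powr (1 / p - \<alpha>)) powr real_of_int n"
  proof -
    have "(1 / p - \<alpha>) * real m = real m / p + - (\<alpha> * real m)"
      by (simp add: left_diff_distrib)
    then show ?thesis
      by (simp only: B_def n powr_powr of_int_of_nat_eq powr_add mult_ac)
  qed
  finally show ?thesis .
qed

lemma schauder_tail_le:
  assumes "f \<in> holder_space \<alpha>" "0 < \<alpha>"
  shows "schauder_tail f n
    \<le> ennreal (2 powr (1 - \<alpha>) * holder_const \<alpha> f / (1 - 2 powr (- \<alpha>)) * (2 powr (- \<alpha>)) ^ n)"
proof -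
  define q where "q = (2::real) powr (- \<alpha>)"
  define c where "c = 2 powr (1 - \<alpha>) * holder_const \<alpha> f"
  have q: "0 \<le> q" "q < 1"
    using assms(2) powr_less_mono[of "- \<alpha>" 0 2] by (auto simp: q_def)
  have "0 \<le> c"
    by (simp add: c_def)
  have q_pow: "q ^ m = 2 powr (- (\<alpha> * real m))" for m
    by (simp add: q_def powr_powr powr_realpow[symmetric])
  have "schauder_tail f n \<le> ennreal (c * (q ^ n / (1 - q)))"
    unfolding schauder_tail_def
  proof (rule infsum_ennreal_le)
    show "((\<lambda>m. c * q ^ m) has_sum c * (q ^ n / (1 - q))) {n..}"
      using q by (intro has_sum_cmult_right has_sum_geometric_atLeast)
    fix m
    show "0 \<le> c * q ^ m"
      using q \<open>0 \<le> c\<close> by simp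
    have "(SUP k\<in>level_indices (int m). ennreal \<bar>schauder_coeff f (int m) k\<bar>)
        \<le> ennreal (2 powr (real m / 2) * (c * q ^ m))"
      using schauder_coeff_le[OF assms(1)] unfolding c_def q_pow
      by (intro SUP_least ennreal_leI)
    then have "ennreal (2 powr (- (real m / 2))) *
          (SUP k\<in>level_indices (int m). ennreal \<bar>schauder_coeff f (int m) k\<bar>)
        \<le> ennreal (2 powr (- (real m / 2))) * ennreal (2 powr (real m / 2) * (c * q ^ m))"
      by (rule mult_left_mono) simp
    also have "\<dots> = ennreal (c * q ^ m)"
      using q \<open>0 \<le> c\<close> by (simp add: ennreal_mult[symmetric] powr_minus)
    finally show "ennreal (2 powr (- (real m / 2))) *
          (SUP k\<in>level_indices (int m). ennreal \<bar>schauder_coeff f (int m) k\<bar>)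
        \<le> ennreal (c * q ^ m)" .
  qed
  then show ?thesis
    by (simp add: c_def q_def)
qed

section \<open>The embedding into the energy space\<close>

text \<open>
  The \<open>p\<close>-th powers of the level bounds have ratio \<open>q = r\<^sup>p = 2\<^bsup>1-\<alpha>p\<^esup>\<close>, and
  \<open>1 / (q * (1 - q))\<close> is the sum of the powers of \<open>q\<close> from exponent \<open>-1\<close> on.
\<close>

lemma lp_norm_level_energy_le:
  assumes "f \<in> holder_space \<alpha>" "1 < p" "1 < \<alpha> * p"
  defines "q \<equiv> 2 powr (1 - \<alpha> * p)"
  shows "lp_norm p {-1..} (\<lambda>n. ennreal (level_energy p f n))
    \<le> ennreal (2 powr (1 - \<alpha>) * holder_const \<alpha> f * (1 / (q * (1 - q))) powr (1 / p))"
proof (rule lp_norm_le)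
  have "q < 1"
    using assms(3) powr_less_mono[of "1 - \<alpha> * p" 0 2] by (simp add: q_def)
  then have "((\<lambda>n. q powr real_of_int n) has_sum 1 / (q * (1 - q))) {-1..}"
    by (intro has_sum_powr_int_atLeast) (auto simp: q_def)
  moreover have "q powr x = ((2 powr (1 / p - \<alpha>)) powr x) powr p" for x
  proof -
    have "(1 - \<alpha> * p) * x = (1 / p - \<alpha>) * x * p"
      using assms(2) by (simp add: field_simps)
    then show ?thesis
      by (simp only: q_def powr_powr)
  qed
  ultimately show "((\<lambda>n. ((2 powr (1 / p - \<alpha>)) powr real_of_int n) powr p)
      has_sum 1 / (q * (1 - q))) {-1..}"
    by simp
qed (use level_energy_le[OF assms(1,2)] assms(2) in \<open>auto intro!: ennreal_leI\<close>)

lemma lp_norm_schauder_tail_le: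
  assumes "f \<in> holder_space \<alpha>" "0 < \<alpha>" "0 < p"
  shows "lp_norm p UNIV (schauder_tail f)
    \<le> ennreal (2 powr (1 - \<alpha>) * holder_const \<alpha> f / (1 - 2 powr (- \<alpha>))
        * (1 / (1 - 2 powr (- \<alpha> * p))) powr (1 / p))"
proof (rule lp_norm_le)
  have lt1: "(2::real) powr (- \<alpha>) < 1" "(2::real) powr (- \<alpha> * p) < 1"
    using assms powr_less_mono[of "- \<alpha>" 0 2] powr_less_mono[of "- \<alpha> * p" 0 2] by auto
  then show "0 \<le> 2 powr (1 - \<alpha>) * holder_const \<alpha> f / (1 - 2 powr (- \<alpha>))"
    by simp
  have "((\<lambda>n. (2 powr (- \<alpha> * p)) ^ n) has_sum (2 powr (- \<alpha> * p)) ^ 0 / (1 - 2 powr (- \<alpha> * p)))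
      {0::nat..}"
    using lt1 by (intro has_sum_geometric_atLeast) auto
  moreover have "(2 powr (- \<alpha> * p)) ^ n = ((2 powr (- \<alpha>)) ^ n) powr p" for n
    by (simp add: powr_realpow[symmetric] powr_powr algebra_simps)
  ultimately show "((\<lambda>n. ((2 powr (- \<alpha>)) ^ n) powr p)
      has_sum 1 / (1 - 2 powr (- \<alpha> * p))) UNIV"
    by (simp add: atLeast_0)
qed (use schauder_tail_le assms in auto)

theorem proposition4p1:
  fixes p \<alpha> :: real
  assumes "p > 1" and "0 < \<alpha>" and "\<alpha> \<le> 1" and "\<alpha> * p > 1"
  shows "(\<exists>C::real. C > 0 \<and>
            (\<forall>f\<in>holder_space \<alpha>. energy_norm p f \<le> ennreal C * holder_norm \<alpha> f))
         \<and> holder_space \<alpha> \<subseteq> energy_space p"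
proof -
  define q where "q = (2::real) powr (1 - \<alpha> * p)"
  define A where "A = 2 powr (1 - \<alpha>) * (1 / (q * (1 - q))) powr (1 / p)"
  define B where "B = 2 powr (1 - \<alpha>) / (1 - 2 powr (- \<alpha>))
      * (1 / (1 - 2 powr (- \<alpha> * p))) powr (1 / p)"
  have nonneg: "0 \<le> A" "0 \<le> B"
    using assms(2) powr_less_mono[of "- \<alpha>" 0 2] by (auto simp: A_def B_def)
  have bound: "energy_norm p f \<le> ennreal (1 + A + B) * holder_norm \<alpha> f"
    if f: "f \<in> holder_space \<alpha>" for f
  proof -
    have L: "ennreal (holder_const \<alpha> f) = holder_seminorm \<alpha> f"
      using f by (simp add: holder_space_def)
    have le: "unif_norm f \<le> holder_norm \<alpha> f" "holder_seminorm \<alpha> f \<le> holder_norm \<alpha> f"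
      by (simp_all add: holder_norm_def)
    have "lp_norm p {-1..} (\<lambda>n. ennreal (level_energy p f n)) \<le> ennreal (A * holder_const \<alpha> f)"
      using lp_norm_level_energy_le[OF f assms(1,4)] by (simp add: A_def q_def mult_ac)
    also have "\<dots> \<le> ennreal A * holder_norm \<alpha> f"
      using nonneg le by (simp add: ennreal_mult L mult_left_mono)
    finally have A: "lp_norm p {-1..} (\<lambda>n. ennreal (level_energy p f n))
        \<le> ennreal A * holder_norm \<alpha> f" .
    have "lp_norm p UNIV (schauder_tail f) \<le> ennreal (B * holder_const \<alpha> f)"
      using lp_norm_schauder_tail_le[OF f assms(2), of p] assms(1) by (simp add: B_def mult_ac)
    also have "\<dots> \<le> ennreal B * holder_norm \<alpha> f"
      using nonneg le by (simp add: ennreal_mult L mult_left_mono)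
    finally have "energy_norm p f
        \<le> holder_norm \<alpha> f + ennreal A * holder_norm \<alpha> f + ennreal B * holder_norm \<alpha> f"
      unfolding energy_norm_def using A le by (intro add_mono)
    also have "\<dots> = ennreal (1 + A + B) * holder_norm \<alpha> f"
      using nonneg by (simp add: distrib_right)
    finally show ?thesis .
  qed
  have "f \<in> energy_space p" if f: "f \<in> holder_space \<alpha>" for f
  proof -
    have cont: "continuous_on {0..1} f"
      using f assms(2) by (rule holder_imp_continuous_on)
    have "holder_norm \<alpha> f < top"
      using unif_norm_finite[OF cont] f by (simp add: holder_norm_def holder_space_def)
    then have "ennreal (1 + A + B) * holder_norm \<alpha> f < top"
      by (simp add: ennreal_mult_less_top)
    with bound[OF f] cont show ?thesis
      by (simp add: energy_space_def C01_def le_less_trans)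
  qed
  moreover have "1 + A + B > 0"
    using nonneg by linarith
  ultimately show ?thesis
    using bound by blast
qed

end
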